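(* For every integer $k\geq 1$, $\gamma(P(5k,k))=3k$.
   Context: The generalized Petersen graph $P(n,k)$ is the graph on $2n$ vertices with vertex set $\{v_i,u_i: 0\leq i\leq n-1\}$ and edge set $\{v_iv_{i+1},\ v_iu_i,\ u_iu_{i+k}: 0\leq i\leq n-1\}$, subscripts taken modulo $n$. For a graph $G$, a set $S\subseteq V(G)$ is a dominating set if every vertex of $G$ is in $S$ or adjacent to some vertex of $S$; the domination number $\gamma(G)$ is the minimum cardinality of a dominating set of $G$. *)

theory Defs
  imports Graph_Theory.Pair_Digraph
begin

text \<open>
  Following the conventions of Graph_Theory, an undirected graph is a symmetric digraph:
  an edge \<open>xy\<close> is the pair of arcs \<open>(x, y)\<close>, \<open>(y, x)\<close>.
\<close>

text \<open>\<open>Outer i\<close> and \<open>Inner i\<close> are the vertices usually written $v_i$ and $u_i$.\<close>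

datatype petersen_vertex = Outer nat | Inner nat

definition petersen_edges :: "nat \<Rightarrow> nat \<Rightarrow> petersen_vertex rel" where
  "petersen_edges n k =
     {(Outer i, Outer ((i + 1) mod n)) | i. i < n} \<union>
     {(Outer i, Inner i) | i. i < n} \<union>
     {(Inner i, Inner ((i + k) mod n)) | i. i < n}"

definition gen_petersen :: "nat \<Rightarrow> nat \<Rightarrow> petersen_vertex pair_pre_digraph" where
  "gen_petersen n k =
     \<lparr> pverts = Outer ` {..<n} \<union> Inner ` {..<n},
       parcs = petersen_edges n k \<union> (petersen_edges n k)\<inverse> \<rparr>"

text \<open>The side conditions rule out loops among the outer and the inner edges.\<close>

lemma pair_graph_gen_petersen:
  assumes "n \<ge> 2" and "\<not> n dvd k"
  shows "pair_graph (gen_petersen n k)"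
proof -
  have fin: "finite (petersen_edges n k)"
    by (simp add: petersen_edges_def)
  have 1: "(i + 1) mod n \<noteq> i" if "i < n" for i
    using that assms(1) by (cases "i + 1 = n") auto
  have 2: "(i + k) mod n \<noteq> i" if "i < n" for i
  proof
    assume "(i + k) mod n = i"
    hence "(i + k) mod n = i mod n" using that by simp
    hence "n dvd (i + k) - i" by (metis le_add1 mod_eq_dvd_iff_nat)
    thus False using assms(2) by simp
  qed
  show ?thesis
  proof
    show "symmetric (with_proj (gen_petersen n k))"
      by (auto simp: symmetric_def gen_petersen_def sym_def)
    show "fst e \<noteq> snd e" if "e \<in> parcs (gen_petersen n k)" for e
      using that 1 2 by (auto simp: gen_petersen_def petersen_edges_def) metis+
  qed (use fin in \<open>auto simp: gen_petersen_def petersen_edges_def\<close>)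
qed

lemma card_pverts_gen_petersen: "card (pverts (gen_petersen n k)) = 2 * n"
proof -
  have "card (Outer ` {..<n} \<union> Inner ` {..<n}) = card (Outer ` {..<n}) + card (Inner ` {..<n})"
    by (rule card_Un_disjoint) auto
  thus ?thesis
    by (simp add: gen_petersen_def card_image inj_on_def)
qed

definition dominating_set :: "('a, 'b) pre_digraph \<Rightarrow> 'a set \<Rightarrow> bool" where
  "dominating_set G S \<longleftrightarrow>
     S \<subseteq> verts G \<and> (\<forall>v \<in> verts G. v \<in> S \<or> (\<exists>u \<in> S. v \<rightarrow>\<^bsub>G\<^esub> u))"

text \<open>Finiteness is required because \<open>card\<close> is 0 on infinite sets.\<close>

definition domination_number :: "('a, 'b) pre_digraph \<Rightarrow> nat" where
  "domination_number G = (LEAST m. \<exists>S. dominating_set G S \<and> finite S \<and> card S = m)"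

lemma domination_number_attained:
  assumes "finite (verts G)"
  shows "\<exists>S. dominating_set G S \<and> finite S \<and> card S = domination_number G"
  unfolding domination_number_def
  by (rule LeastI_ex) (use assms in \<open>auto simp: dominating_set_def\<close>)

end

theory Submission
  imports Defs "HOL-Library.Numeral_Type" "HOL-Number_Theory.Cong"
begin

text \<open>
  The vertices split into columns: column \<open>j\<close> consists of the five outer and the five inner
  vertices with indices \<open>j + t * k\<close> for \<open>t\<close> in the residues modulo 5. Its inner vertices form a
  5-cycle, and each of its outer vertices is joined to its own inner vertex and to the outer
  vertices with the same \<open>t\<close> in columns \<open>j - 1\<close> and \<open>j + 1\<close>, where column \<open>j + k\<close> is column \<open>j\<close> with
  its positions rotated by one. The claim is that a dominating set
  meets a column in three vertices on average, and that this can be attained.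

  For the lower bound, a column contains at least two vertices, and exactly two only if these are
  the inner vertices \<open>q - 1\<close> and \<open>q + 1\<close> for some \<open>q\<close>. Then the outer vertices \<open>q\<close>, \<open>q - 2\<close>, \<open>q + 2\<close>
  must be dominated by outer vertices of the two neighbouring columns, which need more vertices in
  turn. The surplus that pays for a deficit may lie several columns away, however. Therefore the
  columns are read from left to right and a potential, \<open>credit\<close>, with values 0, 1 and 2
  bounds what can still be saved to the right, given the part of the set in the current column
  and the outer vertices there that still wait to be dominated from the right. Lemma
  \<open>credit_step\<close> says that each column contains at least three vertices plus the increase of the
  credit. Summed over a whole period the credit cancels (\<open>periodic_domination_bound\<close>).

  For the upper bound, each index \<open>i\<close> gets a label modulo 5 such that the label increases by 1 or 2
  from \<open>i\<close> to \<open>i + 1\<close> and changes by 1 or -1 from \<open>i\<close> to \<open>i + k\<close>. The set takes the inner vertices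
  with label 0 and the outer ones with label 2 or 3. An outer vertex labelled 1 is followed
  by a label 2 or 3, one labelled 4 is preceded by one, and an inner vertex labelled 1 or 4 has a
  neighbour labelled 0 on its 5-cycle. Every column carries each label once, so it contains
  three vertices of the set. Rounding a line of slope between 1 and 2 gives such a labelling.
\<close>

section \<open>The credit of a column\<close>

lemma all_mod_5: "(\<forall>x::5. P x) \<longleftrightarrow> P 0 \<and> P 1 \<and> P 2 \<and> P 3 \<and> P 4"
proof -
  have "(UNIV :: 5 set) = {0, 1, 2, 3, 4}"
    by (rule sym, rule card_subset_eq) auto
  thus ?thesis
    by (metis UNIV_I empty_iff insert_iff)
qed

lemma ex_mod_5: "(\<exists>x::5. P x) \<longleftrightarrow> P 0 \<or> P 1 \<or> P 2 \<or> P 3 \<or> P 4"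
  using all_mod_5[of "\<lambda>x. \<not> P x"] by blast

text \<open>
  In the next three definitions \<open>A\<close> is the set of positions of the chosen outer vertices of a column
  and \<open>N\<close> is the set of those positions whose outer vertex is dominated neither from within the
  column nor from its left, so that the column to the right must contain \<open>N\<close>.
  Compared with three per column, the columns to the right save at most two vertices in total after
  an abundant column, at most one after any other supportive column and none otherwise.
\<close>

definition supportive :: "5 set \<Rightarrow> 5 set \<Rightarrow> bool" where
  "supportive A N \<longleftrightarrow> N = {} \<or> (\<exists>t. {t - 1, t + 1} \<subseteq> A) \<or> (\<exists>t. {t - 2, t + 2} \<subseteq> A \<and> N \<subseteq> {t})"

definition abundant :: "5 set \<Rightarrow> 5 set \<Rightarrow> bool" where
  "abundant A N \<longleftrightarrow> N = {} \<and> (\<exists>q. {q, q - 2, q + 2} \<subseteq> A)"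

definition credit :: "5 set \<Rightarrow> 5 set \<Rightarrow> nat" where
  "credit A N = of_bool (supportive A N) + of_bool (abundant A N)"

text \<open>
  The next two lemmas describe what a column with two inner vertices leaves to its neighbours.
  Neither one vertex nor two adjacent ones dominate a 5-cycle, so \<open>x\<close> and \<open>y\<close> are \<open>q - 1\<close> and \<open>q + 1\<close> for
  some \<open>q\<close>.
\<close>

lemma pair_avoids_triple:
  fixes x y :: 5
  assumes "\<forall>w. w \<in> {x, x + 1, x - 1} \<or> w \<in> {y, y + 1, y - 1}"
  shows "\<exists>q. {q, q - 2, q + 2} \<inter> {x, y} = {}"
proof -
  have "\<forall>x y :: 5. (\<forall>w. w \<in> {x, x + 1, x - 1} \<or> w \<in> {y, y + 1, y - 1}) \<longrightarrow>
      (\<exists>q. {q, q - 2, q + 2} \<inter> {x, y} = {})"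
    by (simp add: all_mod_5 ex_mod_5)
  from this[rule_format, OF assms[rule_format]] show ?thesis .
qed

text \<open>
  Here \<open>z\<close> is the position of an additional outer vertex. If no two of the missed
  positions are at distance 2, then exactly two are missed and they are adjacent, so \<open>x\<close>, \<open>y\<close>, \<open>z\<close> are
  consecutive. The middle one is \<open>z\<close>, because adjacent \<open>x\<close>, \<open>y\<close> would leave undominated the vertex
  opposite to them, which is not next to either and hence not \<open>z\<close>.
\<close>

lemma triple_avoids_pair:
  fixes x y z :: 5
  assumes "\<forall>w. w = z \<or> w \<in> {x, x + 1, x - 1} \<or> w \<in> {y, y + 1, y - 1}"
  shows "(\<exists>t. {t - 1, t + 1} \<inter> {x, y, z} = {}) \<or> {z - 2, z + 2} \<inter> {x, y, z} = {}"
proof -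
  have "\<forall>x y z :: 5. (\<forall>w. w = z \<or> w \<in> {x, x + 1, x - 1} \<or> w \<in> {y, y + 1, y - 1}) \<longrightarrow>
      (\<exists>t. {t - 1, t + 1} \<inter> {x, y, z} = {}) \<or> {z - 2, z + 2} \<inter> {x, y, z} = {}"
    by (simp add: all_mod_5 ex_mod_5)
  from this[rule_format, OF assms[rule_format]] show ?thesis .
qed

lemma abundant_imp_card_ge_3:
  assumes "abundant A N"
  shows "card A \<ge> 3"
proof -
  obtain q where "{q, q - 2, q + 2} \<subseteq> A"
    using assms by (auto simp: abundant_def)
  hence "card {q, q - 2, q + 2} \<le> card A" by (intro card_mono) simp_all
  thus ?thesis by simp
qed

text \<open>
  Without inner vertices all five outer ones are needed, which pays for any credit. Otherwise
  credit of the left column is needed only if the column keeps more credit than it has vertices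
  beyond three, and there are two sources for it. If the column has no outer vertex, the left one
  waits for nothing and is supportive for that reason. If the column itself waits for nothing, then
  the outer positions that it misses are taken in the left column, and they form one of the
  patterns that carry credit.
\<close>

lemma credit_step:
  fixes A\<^sub>0 N\<^sub>0 A I :: "5 set"
  assumes inner: "\<forall>t. t \<in> A \<or> t \<in> I \<or> t - 1 \<in> I \<or> t + 1 \<in> I"
    and left: "N\<^sub>0 \<subseteq> A"
  shows "credit A (- (A\<^sub>0 \<union> A \<union> I)) + 3 \<le> credit A\<^sub>0 N\<^sub>0 + card A + card I"
proof -
  define N where "N = - (A\<^sub>0 \<union> A \<union> I)"
  have fin: "finite A" by simp
  have le_one: "credit A N \<le> 1" if "card A < 3"
    using that abundant_imp_card_ge_3[of A N] by (auto simp: credit_def)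
  have le_two: "credit A N \<le> 2"
    by (simp add: credit_def)
  have supportive_ge: "credit A\<^sub>0 N\<^sub>0 \<ge> 1" if "supportive A\<^sub>0 N\<^sub>0"
    using that by (simp add: credit_def)
  have from_left: "B \<subseteq> A\<^sub>0" if "N = {}" "B \<inter> (A \<union> I) = {}" for B
    using that unfolding N_def by blast
  consider "card I = 0" | "card I = 1" | "card I = 2" | "card I \<ge> 3" by linarith
  hence "credit A N + 3 \<le> credit A\<^sub>0 N\<^sub>0 + card A + card I"
  proof cases
    case 1
    hence "A = UNIV" using inner by auto
    hence "card A = 5" by simp
    thus ?thesis using le_two by linarith
  next
    case 2
    then obtain t where I: "I = {t}" by (rule card_1_singletonE)
    \<comment> \<open>The two inner vertices far from \<open>t\<close> can only be dominated by their outer neighbours.\<close>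
    have far: "{t - 2, t + 2} \<subseteq> A"
      using inner[rule_format, of "t - 2"] inner[rule_format, of "t + 2"] I by auto
    consider "card A = 2" | "card A = 3" | "card A \<ge> 4"
      using card_mono[OF fin far] by force
    thus ?thesis
    proof cases
      case 1
      hence A: "A = {t - 2, t + 2}"
        using card_subset_eq[OF fin far] by simp
      have "\<not> abundant A N"
        using 1 abundant_imp_card_ge_3[of A N] by auto
      moreover have "supportive A\<^sub>0 N\<^sub>0" if "supportive A N"
      proof -
        have no_near: "\<not> {s - 1, s + 1} \<subseteq> A" for s
        proof -
          have "\<forall>s t :: 5. \<not> {s - 1, s + 1} \<subseteq> {t - 2, t + 2}" by (simp add: all_mod_5)
          thus ?thesis using A by blast
        qed
        have far_eq: "s = t" if "{s - 2, s + 2} \<subseteq> A" for s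
        proof -
          have "\<forall>s t :: 5. {s - 2, s + 2} \<subseteq> {t - 2, t + 2} \<longrightarrow> s = t" by (simp add: all_mod_5)
          thus ?thesis using A that by blast
        qed
        \<comment> \<open>The position \<open>t\<close> itself is taken by an inner vertex, so it cannot be in \<open>N\<close>.\<close>
        have "N \<subseteq> {t}" using \<open>supportive A N\<close> no_near far_eq by (auto simp: supportive_def)
        hence "N = {}" using I by (auto simp: N_def)
        hence "{t - 1, t + 1} \<subseteq> A\<^sub>0" by (rule from_left) (simp add: A I)
        thus ?thesis by (auto simp: supportive_def)
      qed
      ultimately have "credit A N \<le> credit A\<^sub>0 N\<^sub>0"
        by (simp add: credit_def)
      thus ?thesis using 1 2 by linarith
    next
      case 2
      have "supportive A\<^sub>0 N\<^sub>0" if ab: "abundant A N"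
      proof -
        obtain q where q: "{q, q - 2, q + 2} \<subseteq> A" and N: "N = {}"
          using ab by (auto simp: abundant_def)
        have A: "A = {q, q - 2, q + 2}"
          using card_subset_eq[OF fin q] 2 by simp
        \<comment> \<open>The inner vertices at \<open>q - 1\<close> and \<open>q + 1\<close> have no chosen outer neighbour, so \<open>I\<close> must
          dominate both, which fixes its only element.\<close>
        have "\<forall>q t :: 5. {t - 2, t + 2} \<subseteq> {q, q - 2, q + 2} \<longrightarrow> 
          q - 1 \<in> {q, q - 2, q + 2} \<union> {t, t + 1, t - 1} \<longrightarrow>
          q + 1 \<in> {q, q - 2, q + 2} \<union> {t, t + 1, t - 1} \<longrightarrow> t = q"
          by (simp add: all_mod_5)
        moreover have "q - 1 \<in> {q, q - 2, q + 2} \<union> {t, t + 1, t - 1}"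
             "q + 1 \<in> {q, q - 2, q + 2} \<union> {t, t + 1, t - 1}"
          using inner[rule_format, of "q - 1"] inner[rule_format, of "q + 1"] A I by auto
        ultimately have "t = q"
          using far A by blast
        with N have "{q - 1, q + 1} \<subseteq> A\<^sub>0" by (intro from_left) (simp_all add: A I)
        thus ?thesis by (auto simp: supportive_def)
      qed
      hence "credit A N \<le> credit A\<^sub>0 N\<^sub>0 + 1"
        by (auto simp: credit_def)
      thus ?thesis using 2 \<open>card I = 1\<close> by linarith
    next
      case 3
      thus ?thesis using le_two \<open>card I = 1\<close> by linarith
    qed
  next
    case 3
    note I2 = this
    then obtain x y where I: "I = {x, y}" by (auto simp: card_2_iff)
    consider "card A = 0" | "card A = 1" | "card A \<ge> 2" by linarith
    thus ?thesis
    proof cases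
      case 1
      hence A: "A = {}" by simp
      hence "supportive A\<^sub>0 N\<^sub>0" using left by (simp add: supportive_def)
      moreover have "abundant A\<^sub>0 N\<^sub>0" if "supportive A N"
      proof -
        have "\<forall>w. w \<in> {x, x + 1, x - 1} \<or> w \<in> {y, y + 1, y - 1}"
          using inner A I by (auto simp: algebra_simps)
        then obtain q where "{q, q - 2, q + 2} \<inter> {x, y} = {}"
          using pair_avoids_triple by blast
        moreover have "N = {}" using that A by (simp add: supportive_def)
        ultimately have "{q, q - 2, q + 2} \<subseteq> A\<^sub>0"
          using A I by (intro from_left) simp_all
        thus ?thesis using left A by (auto simp: abundant_def)
      qed
      moreover have "\<not> abundant A N" using A by (simp add: abundant_def)
      ultimately have "credit A N + 1 \<le> credit A\<^sub>0 N\<^sub>0"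
        by (auto simp: credit_def)
      thus ?thesis using I2 by linarith
    next
      case 2
      then obtain z where A: "A = {z}" by (rule card_1_singletonE)
      have "\<not> abundant A N" using A by (auto simp: abundant_def)
      moreover have "supportive A\<^sub>0 N\<^sub>0" if "supportive A N"
      proof -
        have N: "N = {}" using that A by (auto simp: supportive_def)
        have "\<forall>w. w = z \<or> w \<in> {x, x + 1, x - 1} \<or> w \<in> {y, y + 1, y - 1}"
          using inner A I by (auto simp: algebra_simps)
        hence "(\<exists>t. {t - 1, t + 1} \<inter> {x, y, z} = {}) \<or> {z - 2, z + 2} \<inter> {x, y, z} = {}"
          by (rule triple_avoids_pair)
        moreover have "B \<subseteq> A\<^sub>0" if "B \<inter> {x, y, z} = {}" for B
          using that N A I by (intro from_left) (auto simp: insert_commute)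
        ultimately have "(\<exists>t. {t - 1, t + 1} \<subseteq> A\<^sub>0) \<or> {z - 2, z + 2} \<subseteq> A\<^sub>0" by blast
        thus ?thesis using left A unfolding supportive_def by blast
      qed
      ultimately have "credit A N \<le> credit A\<^sub>0 N\<^sub>0"
        by (simp add: credit_def)
      thus ?thesis using 2 I2 by linarith
    next
      case 3
      thus ?thesis using I2 le_one le_two by linarith
    qed
  next
    case 4
    have "credit A\<^sub>0 N\<^sub>0 \<ge> 1" if "card A = 0"
      using that left by (intro supportive_ge) (simp add: supportive_def)
    thus ?thesis using 4 le_one le_two by linarith
  qed
  thus ?thesis by (simp add: N_def)
qed


section \<open>Columns of a periodic predicate\<close>

lemma sum_shift_period:
  fixes f :: "nat \<Rightarrow> nat"
  assumes "\<And>i. f (i + n) = f i"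
  shows "(\<Sum>i<n. f (i + c)) = (\<Sum>i<n. f i)"
proof (induction c)
  case (Suc c)
  have "f c + (\<Sum>i<n. f (Suc i + c)) = (\<Sum>i<n. f (i + c)) + f (n + c)"
    using sum.lessThan_Suc[of "\<lambda>i. f (i + c)" n] sum.lessThan_Suc_shift[of "\<lambda>i. f (i + c)" n]
    by simp
  thus ?case using Suc assms[of c] by (simp add: add.commute)
qed simp

text \<open>
  All indices \<open>t\<close> are admitted, not only those below 5: for \<open>P\<close> of period \<open>5 * k\<close> the result is the
  same, and rotating a column amounts to a shift of \<open>j\<close> by a multiple of \<open>k\<close>. In particular the twist
  by which column \<open>k\<close> is a rotated copy of column 0 needs no separate treatment when \<open>j\<close> runs over a
  full period \<open>5 * k\<close>, in which every vertex is counted five times.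
\<close>

definition column :: "nat \<Rightarrow> (nat \<Rightarrow> bool) \<Rightarrow> nat \<Rightarrow> 5 set" where
  "column k P j = of_nat ` {t. P (j + t * k)}"

lemma of_nat_eq_mod_5: "(of_nat s :: 5) = of_nat t \<longleftrightarrow> s mod 5 = t mod 5"
  by (simp add: of_nat_eq_iff_cong_CHAR cong_def)

lemma ex_of_nat_mod_5: "\<exists>t. (x :: 5) = of_nat t"
proof -
  have "x = of_nat 0 \<or> x = of_nat 1 \<or> x = of_nat 2 \<or> x = of_nat 3 \<or> x = of_nat 4"
    using all_mod_5[of "\<lambda>x. x = 0 \<or> x = 1 \<or> x = 2 \<or> x = 3 \<or> x = 4"] by simp
  thus ?thesis by blast
qed

context
  fixes k :: nat and P :: "nat \<Rightarrow> bool"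
  assumes period: "\<And>i. P (i + 5 * k) = P i"
begin

lemma period_mult: "P (i + m * (5 * k)) = P i"
proof (induction m)
  case (Suc m)
  thus ?case using period[of "i + m * (5 * k)"] by (simp add: algebra_simps)
qed simp

lemma step_mod_5: "P (j + (t mod 5) * k) = P (j + t * k)"
proof -
  have "t * k = (t mod 5) * k + (t div 5) * (5 * k)"
    by (metis add.commute add_mult_distrib div_mult_mod_eq mult.assoc)
  thus ?thesis using period_mult[of "j + (t mod 5) * k" "t div 5"] by (simp add: add.assoc)
qed

lemma of_nat_mem_column: "of_nat t \<in> column k P j \<longleftrightarrow> P (j + t * k)"
  unfolding column_def image_iff of_nat_eq_mod_5 using step_mod_5 by (metis mem_Collect_eq)

lemma card_column: "card (column k P j) = (\<Sum>t<5. of_bool (P (j + t * k)))"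
proof -
  have "column k P j = of_nat ` {t \<in> {..<5}. P (j + t * k)}" (is "_ = ?R")
  proof (intro set_eqI)
    fix x :: 5
    obtain t where x: "x = of_nat t" using ex_of_nat_mod_5 by blast
    have "x = of_nat (t mod 5)" by (simp add: x of_nat_eq_mod_5)
    thus "x \<in> column k P j \<longleftrightarrow> x \<in> ?R"
      using of_nat_mem_column[of "t mod 5" j]
      by (auto simp: of_nat_eq_mod_5 of_nat_mem_column image_iff step_mod_5)
  qed
  also have "card \<dots> = card {t \<in> {..<5}. P (j + t * k)}"
    by (rule card_image) (auto simp: inj_on_def of_nat_eq_mod_5)
  also have "{t \<in> {..<5}. P (j + t * k)} = {..<5} \<inter> {t. P (j + t * k)}" by auto
  also have "card \<dots> = (\<Sum>t<5. of_bool (P (j + t * k)))" by (subst sum_of_bool_eq) simp_all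
  finally show ?thesis .
qed

lemma column_period: "column k P (j + 5 * k) = column k P j"
proof -
  have "P (j + 5 * k + t * k) = P (j + t * k)" for t
    using period[of "j + t * k"] by (simp add: ac_simps)
  thus ?thesis by (simp add: column_def)
qed

lemma sum_card_columns: "(\<Sum>j<5 * k. card (column k P j)) = 5 * card {i \<in> {..<5 * k}. P i}"
proof -
  have "(\<Sum>j<5 * k. card (column k P j)) = (\<Sum>t<5. \<Sum>j<5 * k. of_bool (P (j + t * k)))"
    by (simp only: card_column) (rule sum.swap)
  also have "\<dots> = (\<Sum>t<5::nat. \<Sum>j<5 * k. of_bool (P j))"
    by (intro sum.cong refl sum_shift_period) (simp add: period)
  also have "(\<Sum>j<5 * k. of_bool (P j)) = card ({..<5 * k} \<inter> {j. P j})"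
    by (subst sum_of_bool_eq) simp_all
  also have "{..<5 * k} \<inter> {j. P j} = {i \<in> {..<5 * k}. P i}" by auto
  finally show ?thesis by simp
qed

end

section \<open>The lower bound\<close>

text \<open>
  The hypotheses are domination of the outer vertex \<open>i + 1\<close> and of the inner vertex \<open>i + k\<close>, shifted so
  that no index is subtracted. Over the period \<open>5 * k\<close> the five-fold count of the chosen vertices
  is at least \<open>3 * (5 * k)\<close>.
\<close>

lemma periodic_domination_bound:
  fixes u v :: "nat \<Rightarrow> bool"
  assumes v_period: "\<And>i. v (i + 5 * k) = v i" and u_period: "\<And>i. u (i + 5 * k) = u i"
    and outer: "\<And>i. v i \<or> v (i + 1) \<or> v (i + 2) \<or> u (i + 1)"
    and inner: "\<And>i. u i \<or> u (i + k) \<or> u (i + 2 * k) \<or> v (i + k)"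
  shows "3 * k \<le> card {i \<in> {..<5 * k}. v i} + card {i \<in> {..<5 * k}. u i}"
proof -
  define A where "A = column k v"
  define I where "I = column k u"
  define N where "N j = - (A j \<union> A (j + 1) \<union> I (j + 1))" for j
  define c where "c j = credit (A (j + 1)) (N j)" for j
  have A: "of_nat t \<in> A j \<longleftrightarrow> v (j + t * k)" for t j
    unfolding A_def by (rule of_nat_mem_column) (rule v_period)
  have I: "of_nat t \<in> I j \<longleftrightarrow> u (j + t * k)" for t j
    unfolding I_def by (rule of_nat_mem_column) (rule u_period)
  have A_period: "A (j + 5 * k) = A j" and I_period: "I (j + 5 * k) = I j" for j
    unfolding A_def I_def by (simp_all add: column_period v_period u_period)
  have step: "c (j + 1) + 3 \<le> c j + card (A (j + 2)) + card (I (j + 2))" for j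
  proof -
    have "\<forall>x. x \<in> A (j + 2) \<or> x \<in> I (j + 2) \<or> x - 1 \<in> I (j + 2) \<or> x + 1 \<in> I (j + 2)"
    proof
      fix x :: 5
      obtain t where t: "x = of_nat t" using ex_of_nat_mod_5 by blast
      \<comment> \<open>Representatives increased by 5, so that \<open>x - 1\<close> is the image of a natural number.\<close>
      have x: "x = of_nat (t + 5)" "x - 1 = of_nat (t + 4)" "x + 1 = of_nat (t + 6)"
        by (simp_all add: t)
      have "u (j + 2 + (t + 4) * k) \<or> u (j + 2 + (t + 5) * k) \<or> u (j + 2 + (t + 6) * k)
          \<or> v (j + 2 + (t + 5) * k)"
        using inner[of "j + 2 + (t + 4) * k"] by (simp add: algebra_simps)
      thus "x \<in> A (j + 2) \<or> x \<in> I (j + 2) \<or> x - 1 \<in> I (j + 2) \<or> x + 1 \<in> I (j + 2)"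
        unfolding x(2,3) unfolding x(1) A I by blast
    qed
    moreover have "N j \<subseteq> A (j + 2)"
    proof
      fix x assume "x \<in> N j"
      moreover obtain t where "x = of_nat t" using ex_of_nat_mod_5 by blast
      ultimately show "x \<in> A (j + 2)"
        using outer[of "j + t * k"] by (auto simp: N_def A I algebra_simps)
    qed
    ultimately show ?thesis
      using credit_step[of "A (j + 2)" "I (j + 2)" "N j" "A (j + 1)"]
      by (simp add: c_def N_def numeral_2_eq_2)
  qed
  have c_period: "c (j + 5 * k) = c j" for j
    using A_period[of j] A_period[of "j + 1"] I_period[of "j + 1"] by (simp add: c_def N_def ac_simps)
  have "(\<Sum>j<5 * k. c (j + 1) + 3)
      \<le> (\<Sum>j<5 * k. c j + card (A (j + 2)) + card (I (j + 2)))"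
    by (intro sum_mono step)
  hence "(\<Sum>j<5 * k. c j) + 15 * k
      \<le> (\<Sum>j<5 * k. c j) + (\<Sum>j<5 * k. card (A j)) + (\<Sum>j<5 * k. card (I j))"
    using sum_shift_period[of c "5 * k" 1, OF c_period]
      sum_shift_period[of "\<lambda>j. card (A j)" "5 * k" 2]
      sum_shift_period[of "\<lambda>j. card (I j)" "5 * k" 2]
    by (simp add: sum.distrib A_period I_period)
  thus ?thesis
    unfolding A_def I_def sum_card_columns[of v, OF v_period] sum_card_columns[of u, OF u_period]
    by simp
qed

lemma mod_add_right_cancel:
  fixes i j c n :: nat
  assumes "j < n" "(j + c) mod n = (i + c) mod n"
  shows "j = i mod n"
proof -
  have "[j + c = i + c] (mod n)" using assms(2) by (simp add: cong_def)
  hence "[j = i] (mod n)" by (simp only: cong_add_rcancel_nat)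
  thus ?thesis using assms(1) by (simp add: cong_def)
qed

lemma dominating_set_gen_petersen_ge:
  assumes "k \<ge> 1" and S: "dominating_set (with_proj (gen_petersen (5 * k) k)) S"
  shows "3 * k \<le> card S"
proof -
  define n where "n = 5 * k"
  have n: "n > 0" using assms(1) by (simp add: n_def)
  define v where "v i \<longleftrightarrow> Outer (i mod n) \<in> S" for i
  define u where "u i \<longleftrightarrow> Inner (i mod n) \<in> S" for i
  have sub: "S \<subseteq> Outer ` {..<n} \<union> Inner ` {..<n}"
    and dom: "\<And>w. w \<in> Outer ` {..<n} \<union> Inner ` {..<n} \<Longrightarrow>
      w \<in> S \<or> (\<exists>x \<in> S. (w, x) \<in> petersen_edges n k \<union> (petersen_edges n k)\<inverse>)"
    using S by (auto simp: dominating_set_def gen_petersen_def n_def)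
  have "3 * k \<le> card {i \<in> {..<5 * k}. v i} + card {i \<in> {..<5 * k}. u i}"
  proof (rule periodic_domination_bound)
    show "v i \<or> v (i + 1) \<or> v (i + 2) \<or> u (i + 1)" for i
      using dom[of "Outer ((i + 1) mod n)"] n mod_add_right_cancel[of _ n 1 i]
      by (auto simp: petersen_edges_def v_def u_def mod_simps)
    show "u i \<or> u (i + k) \<or> u (i + 2 * k) \<or> v (i + k)" for i
      using dom[of "Inner ((i + k) mod n)"] n mod_add_right_cancel[of _ n k i]
      by (auto simp: petersen_edges_def v_def u_def mod_simps mult_2 add.assoc)
  qed (simp_all add: v_def u_def n_def)
  also have "\<dots> = card (Outer ` {i \<in> {..<n}. v i}) + card (Inner ` {i \<in> {..<n}. u i})"
    by (simp add: card_image inj_on_def n_def)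
  also have "\<dots> = card (Outer ` {i \<in> {..<n}. v i} \<union> Inner ` {i \<in> {..<n}. u i})"
    by (rule card_Un_disjoint[symmetric]) auto
  also have "Outer ` {i \<in> {..<n}. v i} \<union> Inner ` {i \<in> {..<n}. u i} = S"
    using sub by (auto simp: v_def u_def)
  finally show ?thesis .
qed

section \<open>A dominating set with three vertices in each column\<close>

text \<open>
  For \<open>k \<ge> 5\<close> the interval has at least six elements and meets every residue class. The smaller \<open>k\<close>
  are the reason for admitting both residues.
\<close>

lemma ex_slope:
  fixes k :: nat
  assumes "k \<ge> 1"
  shows "\<exists>T. k \<le> T \<and> T \<le> 2 * k \<and> (T mod 5 = 1 \<or> T mod 5 = 4)"
  using assms by presburger

context
  fixes k T :: nat
  assumes k: "k \<ge> 1" and T: "k \<le> T" "T \<le> 2 * k" "T mod 5 = 1 \<or> T mod 5 = 4"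
begin

text \<open>
  A step of \<open>i\<close> raises the quotient by 1 or 2 because the slope \<open>T / k\<close> lies between 1 and 2, and \<open>k\<close>
  steps raise it by exactly \<open>T\<close>, which is 1 or -1 modulo 5.
\<close>

definition label :: "nat \<Rightarrow> nat" where
  "label i = (T * i div k) mod 5"

lemma label_Suc: "label (i + 1) = (label i + 1) mod 5 \<or> label (i + 1) = (label i + 2) mod 5"
proof -
  have "(T * i + k) div k \<le> (T * i + T) div k" "(T * i + T) div k \<le> (T * i + 2 * k) div k"
    using T by (auto intro!: div_le_mono)
  hence "T * (i + 1) div k = T * i div k + 1 \<or> T * (i + 1) div k = T * i div k + 2"
    using k by (simp add: algebra_simps) linarith
  thus ?thesis by (auto simp: label_def mod_simps)
qed

lemma label_add_mult: "label (i + t * k) = (label i + t * T) mod 5"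
proof -
  have "T * (i + t * k) = T * i + (t * T) * k" by (simp add: algebra_simps)
  hence "T * (i + t * k) div k = T * i div k + t * T" using k by simp
  thus ?thesis by (simp add: label_def mod_simps)
qed

lemma label_mod: "label (i mod (5 * k)) = label i"
proof -
  have "i = i mod (5 * k) + (5 * (i div (5 * k))) * k"
    by (metis add.commute div_mult_mod_eq mult.assoc mult.commute)
  hence "label i = (label (i mod (5 * k)) + 5 * (i div (5 * k)) * T) mod 5"
    by (metis label_add_mult)
  thus ?thesis by (simp add: label_def mult.assoc)
qed

text \<open>
  Within a column the labels are \<open>label j + t * T\<close> modulo 5, and \<open>T\<close> is invertible modulo 5.
\<close>

lemma card_label_le: "card {i \<in> {..<5 * k}. label i = c} \<le> k"
proof -
  have "card {i \<in> {..<5 * k}. label i = c} \<le> card {..<k}"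
  proof (rule card_inj_on_le[where f = "\<lambda>i. i mod k"])
    show "inj_on (\<lambda>i. i mod k) {i \<in> {..<5 * k}. label i = c}"
    proof (rule inj_onI)
      fix x y
      assume x: "x \<in> {i \<in> {..<5 * k}. label i = c}" and y: "y \<in> {i \<in> {..<5 * k}. label i = c}"
        and xy: "x mod k = y mod k"
      define s t where "s = x div k" and "t = y div k"
      have eq: "x = x mod k + s * k" "y = x mod k + t * k"
        by (simp add: s_def) (simp add: xy t_def)
      have "s < 5" "t < 5" using x y k by (simp_all add: s_def t_def less_mult_imp_div_less)
      moreover have "(label (x mod k) + s * T) mod 5 = (label (x mod k) + t * T) mod 5"
        using x y eq label_add_mult by (metis (mono_tags, lifting) mem_Collect_eq)
      hence "[s * T = t * T] (mod 5)"
        by (simp add: cong_def[symmetric] cong_add_lcancel_nat)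
      moreover have "coprime T 5"
      proof -
        have "coprime (4::nat) 5" using coprime_Suc_right_nat[of 4] by simp
        hence "coprime (T mod 5) 5" using T(3) by (metis coprime_1_left)
        thus ?thesis by simp
      qed
      ultimately have "s = t" by (simp add: cong_mult_rcancel_nat cong_less_modulus_unique_nat)
      thus "x = y" using eq by simp
    qed
  qed (use k in auto)
  thus ?thesis by simp
qed

lemma ex_small_dominating_set:
  "\<exists>S. dominating_set (with_proj (gen_petersen (5 * k) k)) S \<and> finite S \<and> card S \<le> 3 * k"
proof -
  define n where "n = 5 * k"
  have n: "n > 0" using k by (simp add: n_def)
  define L where "L c = {i \<in> {..<n}. label i = c}" for c
  define S where "S = Inner ` L 0 \<union> Outer ` (L 2 \<union> L 3)"
  have label_n: "label (i mod n) = label i" for i using label_mod by (simp add: n_def)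
  have L_mod: "i mod n \<in> L c \<longleftrightarrow> label i = c" for i c using n by (simp add: L_def label_n)
  have Outer_S: "Outer (i mod n) \<in> S \<longleftrightarrow> label i = 2 \<or> label i = 3" for i
    by (auto simp: S_def L_mod image_iff)
  have Inner_S: "Inner (i mod n) \<in> S \<longleftrightarrow> label i = 0" for i
    by (auto simp: S_def L_mod image_iff)
  have label_cases: "label i = 0 \<or> label i = 1 \<or> label i = 2 \<or> label i = 3 \<or> label i = 4" for i
  proof -
    have "label i < 5" by (simp add: label_def)
    thus ?thesis by linarith
  qed
  have ex_pred: "\<exists>p<n. (p + c) mod n = i" if "i < n" "c \<le> n" for i c
    using that n by (intro exI[of _ "(i + (n - c)) mod n"]) (simp add: mod_simps)
  let ?adj = "\<lambda>w x. (w, x) \<in> petersen_edges n k \<union> (petersen_edges n k)\<inverse>"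
  have outer: "Outer i \<in> S \<or> (\<exists>x \<in> S. ?adj (Outer i) x)" if i: "i < n" for i
  proof -
    have im: "i = i mod n" using i by simp
    obtain p where p: "p < n" "(p + 1) mod n = i" using ex_pred[OF i, of 1] n by auto
    have label_p: "label i = (label p + 1) mod 5 \<or> label i = (label p + 2) mod 5"
      using label_Suc[of p] label_n[of "p + 1"] p(2) by simp
    consider "label i = 0" | "label i = 1" | "label i = 2 \<or> label i = 3" | "label i = 4"
      using label_cases[of i] by auto
    thus ?thesis
    proof cases
      case 1
      hence "Inner i \<in> S" using Inner_S[of i] i by simp
      thus ?thesis using i by (intro disjI2 bexI[of _ "Inner i"]) (auto simp: petersen_edges_def)
    next
      case 2
      hence "Outer ((i + 1) mod n) \<in> S" using Outer_S[of "i + 1"] label_Suc[of i] by auto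
      thus ?thesis using i
        by (intro disjI2 bexI[of _ "Outer ((i + 1) mod n)"]) (auto simp: petersen_edges_def)
    next
      case 3
      thus ?thesis using Outer_S[of i] i by simp
    next
      case 4
      hence "Outer p \<in> S" using Outer_S[of p] label_p p(1) label_cases[of p] by auto
      thus ?thesis using p
        by (intro disjI2 bexI[of _ "Outer p"]) (auto simp: petersen_edges_def)
    qed
  qed
  have inner: "Inner i \<in> S \<or> (\<exists>x \<in> S. ?adj (Inner i) x)" if i: "i < n" for i
  proof -
    obtain p where p: "p < n" "(p + k) mod n = i" using ex_pred[OF i, of k] by (auto simp: n_def)
    have label_p: "label i = (label p + T mod 5) mod 5"
      using label_add_mult[of p 1] label_n[of "p + k"] p(2) by (simp add: mod_simps)
    have label_k: "label (i + k) = (label i + T mod 5) mod 5"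
      using label_add_mult[of i 1] by (simp add: mod_simps)
    consider "label i = 0" | "label i = 2 \<or> label i = 3" | "label p = 0" | "label (i + k) = 0"
      using label_cases[of i] label_cases[of p] label_p label_k T(3) by auto
    thus ?thesis
    proof cases
      case 1
      thus ?thesis using Inner_S[of i] i by simp
    next
      case 2
      hence "Outer i \<in> S" using Outer_S[of i] i by simp
      thus ?thesis using i by (intro disjI2 bexI[of _ "Outer i"]) (auto simp: petersen_edges_def)
    next
      case 3
      hence "Inner p \<in> S" using Inner_S[of p] p(1) by simp
      thus ?thesis using p
        by (intro disjI2 bexI[of _ "Inner p"]) (auto simp: petersen_edges_def)
    next
      case 4
      hence "Inner ((i + k) mod n) \<in> S" using Inner_S[of "i + k"] by simp
      thus ?thesis using i
        by (intro disjI2 bexI[of _ "Inner ((i + k) mod n)"]) (auto simp: petersen_edges_def)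
    qed
  qed
  have "S \<subseteq> Outer ` {..<n} \<union> Inner ` {..<n}" by (auto simp: S_def L_def)
  with outer inner have "dominating_set (with_proj (gen_petersen n k)) S"
    by (auto simp: dominating_set_def gen_petersen_def)
  moreover have fin: "finite (L c)" for c by (simp add: L_def)
  hence "finite S" by (simp add: S_def)
  moreover have "card S \<le> 3 * k"
  proof -
    have "card S \<le> card (Inner ` L 0) + card (Outer ` (L 2 \<union> L 3))"
      unfolding S_def by (rule card_Un_le)
    also have "\<dots> \<le> card (L 0) + card (L 2 \<union> L 3)"
      using fin by (intro add_mono card_image_le) simp_all
    also have "\<dots> \<le> card (L 0) + (card (L 2) + card (L 3))"
      by (intro add_left_mono card_Un_le)
    also have "\<dots> \<le> 3 * k"
      using card_label_le[of 0] card_label_le[of 2] card_label_le[of 3] by (simp add: L_def n_def)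
    finally show ?thesis .
  qed
  ultimately show ?thesis unfolding n_def by blast
qed

end

section \<open>The domination number\<close>

theorem corollary3p6:
  fixes k :: nat
  assumes "k \<ge> 1"
  shows "domination_number (with_proj (gen_petersen (5 * k) k)) = 3 * k"
proof (rule antisym)
  let ?G = "with_proj (gen_petersen (5 * k) k)"
  obtain T where "k \<le> T" "T \<le> 2 * k" "T mod 5 = 1 \<or> T mod 5 = 4"
    using ex_slope[OF assms] by blast
  then obtain S where S: "dominating_set ?G S" "finite S" "card S \<le> 3 * k"
    using ex_small_dominating_set[OF assms] by blast
  have "domination_number ?G \<le> card S"
    unfolding domination_number_def by (rule Least_le) (use S in blast)
  with S(3) show "domination_number ?G \<le> 3 * k" by linarith
  have "finite (verts ?G)" by (simp add: gen_petersen_def)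
  then obtain S' where "dominating_set ?G S'" "card S' = domination_number ?G"
    using domination_number_attained by blast
  with dominating_set_gen_petersen_ge[OF assms] show "3 * k \<le> domination_number ?G" by metis
qed

end
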